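(* There exist a symmetric billiard configuration $(K,T)$ and a smooth strictly convex $T$-caustic $C$ in $K$ which possesses no dual convex caustic; that is, there exists no convex $K$-caustic in $T$ which is dual to $C$.
   Context: $\mathbb{R}^2_q,\mathbb{R}^2_p$ are two copies of $\mathbb{R}^2$. "Smooth" means $C^1$-smooth. A convex body is a compact convex set with nonempty interior; it is strictly convex if its boundary contains no segment, and centrally symmetric if $K=-K$. A symmetric billiard configuration is a pair $(K,T)$ of $C^1$-smooth centrally symmetric strictly convex bodies $K\subset\mathbb{R}^2_q$, $T\subset\mathbb{R}^2_p$. $n_D(x)$ denotes the outer normal direction of $D$ at $x\in\partial D$. Billiard dynamics: a $(K,T)$-billiard trajectory is given by sequences $q_k\in\partial K$, $p_k\in\partial T$ ($k\in\mathbb{Z}$) such that $q_{k+1}-q_k$ is a positive multiple of $-n_T(p_k)$ and $p_{k+1}-p_k$ is a positive multiple of $n_K(q_{k+1})$. The polygonal line $(q_k)$ is called a $T$-billiard trajectory in $K$, the polygonal line $(p_k)$ is called a $K$-billiard trajectory in $T$, and the two are dual trajectories. A line is tangent to a compact convex set $C$ if it meets $C$ and $C$ lies in one of the closed half-planes it bounds. A trajectory is tangent to $C$ if the lines containing its segments are all tangent to $C$. A convex $T$-caustic in $K$ is a nonempty compact convex set $C\subset\mathrm{int}(K)$ such that every $T$-billiard trajectory in $K$ having one segment whose line is tangent to $C$ is tangent to $C$ (all its segments). Convex $K$-caustics in $T$ are defined in the same way using $K$-billiard trajectories in $T$. A convex $T$-caustic $C$ in $K$ and a convex $K$-caustic $C'$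 in $T$ are dual if for every $T$-billiard trajectory in $K$ tangent to $C$ the dual $K$-billiard trajectory in $T$ is tangent to $C'$, and vice versa. The caustic $C$ is a smooth strictly convex caustic if moreover $C$ is a $C^1$-smooth strictly convex body. *)

theory Defs
  imports "HOL-Analysis.Analysis"
begin

definition convex_body :: "(real^2) set \<Rightarrow> bool" where
  "convex_body D \<longleftrightarrow> compact D \<and> convex D \<and> interior D \<noteq> {}"

definition strictly_convex_body :: "(real^2) set \<Rightarrow> bool" where
  "strictly_convex_body D \<longleftrightarrow> convex_body D \<and>
     (\<forall>x y. x \<noteq> y \<longrightarrow> \<not> closed_segment x y \<subseteq> frontier D)"

definition centrally_symmetric :: "(real^2) set \<Rightarrow> bool" where
  "centrally_symmetric D \<longleftrightarrow> D = uminus ` D"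

text \<open>
  The boundary is a regular simple closed curve of class \<open>C\<^sup>1\<close>. The parametrization is
  1-periodic on the whole line, so that it is also \<open>C\<^sup>1\<close> at the closing point.
\<close>

definition C1_smooth_boundary :: "(real^2) set \<Rightarrow> bool" where
  "C1_smooth_boundary D \<longleftrightarrow>
     (\<exists>\<gamma> :: real \<Rightarrow> real^2.
        \<gamma> C1_differentiable_on UNIV \<and>
        (\<forall>t. vector_derivative \<gamma> (at t) \<noteq> 0) \<and>
        (\<forall>t. \<gamma> (t + 1) = \<gamma> t) \<and>
        inj_on \<gamma> {0..<1} \<and>
        \<gamma> ` {0..<1} = frontier D)"

definition symmetric_billiard_configuration :: "(real^2) set \<Rightarrow> (real^2) set \<Rightarrow> bool" where
  "symmetric_billiard_configuration K T \<longleftrightarrow>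
     strictly_convex_body K \<and> C1_smooth_boundary K \<and> centrally_symmetric K \<and>
     strictly_convex_body T \<and> C1_smooth_boundary T \<and> centrally_symmetric T"

text \<open>
  The normal direction is represented by the unit vector; for smooth convex bodies it is
  well defined at every boundary point by lemma \<open>outer_normal_ex1\<close> below.
\<close>

definition outer_normal :: "(real^2) set \<Rightarrow> real^2 \<Rightarrow> real^2" where
  "outer_normal D x = (THE n. norm n = 1 \<and> (\<forall>y\<in>D. n \<bullet> (y - x) \<le> 0))"

lemma outer_normal_ex1:
  assumes D: "convex_body D" and C1: "C1_smooth_boundary D" and x: "x \<in> frontier D"
  shows "\<exists>!n. norm n = 1 \<and> (\<forall>y\<in>D. n \<bullet> (y - x) \<le> 0)"
proof (rule ex_ex1I)
  have cl: "closed D" and cv: "convex D" and ne: "interior D \<noteq> {}"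
    using D by (auto simp: convex_body_def compact_imp_closed)
  have xD: "x \<in> D" using x cl frontier_subset_closed by blast
  have "x \<notin> interior D" using x by (simp add: frontier_def)
  then have "x \<notin> rel_interior D"
    using ne rel_interior_nonempty_interior by blast
  then obtain a where a: "a \<noteq> 0" "\<And>y. y \<in> D \<Longrightarrow> a \<bullet> x \<le> a \<bullet> y"
    using supporting_hyperplane_rel_boundary[OF cv xD] by metis
  show "\<exists>n. norm n = 1 \<and> (\<forall>y\<in>D. n \<bullet> (y - x) \<le> 0)"
  proof (intro exI conjI ballI)
    show "norm (- a /\<^sub>R norm a) = 1" using a(1) by simp
    fix y assume "y \<in> D"
    then have "(-a) \<bullet> (y - x) \<le> 0" using a(2) by (simp add: inner_diff_right)
    then show "(- a /\<^sub>R norm a) \<bullet> (y - x) \<le> 0"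
      using a(1) by (simp add: field_simps)
  qed
next
  fix m n :: "real^2"
  assume m: "norm m = 1 \<and> (\<forall>y\<in>D. m \<bullet> (y - x) \<le> 0)"
    and n: "norm n = 1 \<and> (\<forall>y\<in>D. n \<bullet> (y - x) \<le> 0)"
  have cl: "closed D" and ne: "interior D \<noteq> {}"
    using D by (auto simp: convex_body_def compact_imp_closed)
  have fD: "frontier D \<subseteq> D" using cl frontier_subset_closed by blast
  obtain \<gamma> :: "real \<Rightarrow> real^2" where d: "\<gamma> C1_differentiable_on UNIV"
    and v: "\<forall>t. vector_derivative \<gamma> (at t) \<noteq> 0" and per: "\<forall>t. \<gamma> (t + 1) = \<gamma> t"
    and im: "\<gamma> ` {0..<1} = frontier D"
    using C1 unfolding C1_smooth_boundary_def by (elim exE conjE) (rule that, assumption+)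
  have "x \<in> \<gamma> ` {0..<1}" using x im by simp
  then obtain t0 where t0: "t0 \<in> {0..<1}" "\<gamma> t0 = x" by (elim imageE) simp
  obtain t where t: "0 < t" "t < 2" "\<gamma> t = x"
  proof (rule that[of "t0 + 1"])
    show "0 < t0 + 1" "t0 + 1 < 2" using t0 by simp_all
    show "\<gamma> (t0 + 1) = x" using per[rule_format, of t0] t0 by simp
  qed
  have rng: "\<gamma> s \<in> D" if s: "0 < s" "s < 2" for s
  proof (cases "s < 1")
    case True
    then have "\<gamma> s \<in> \<gamma> ` {0..<1}" using s by auto
    then show ?thesis using fD unfolding im by (rule rev_subsetD)
  next
    case False
    then have "\<gamma> (s - 1) \<in> \<gamma> ` {0..<1}" using s by auto
    moreover have "\<gamma> s = \<gamma> (s - 1)" using per[rule_format, of "s - 1"] by simp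
    ultimately show ?thesis using im fD by auto
  qed
  define w where "w = vector_derivative \<gamma> (at t)"
  have w0: "w \<noteq> 0" using v w_def by simp
  have hd: "(\<gamma> has_vector_derivative w) (at t)"
    using d unfolding w_def C1_differentiable_on_eq by (simp add: vector_derivative_works)
  have perp: "k \<bullet> w = 0" if k: "\<forall>y\<in>D. k \<bullet> (y - x) \<le> 0" for k
  proof -
    have "((\<lambda>s. k \<bullet> \<gamma> s) has_vector_derivative k \<bullet> w) (at t)"
      by (rule bounded_linear.has_vector_derivative[OF bounded_linear_inner_right hd])
    then have "((\<lambda>s. k \<bullet> \<gamma> s) has_real_derivative k \<bullet> w) (at t)"
      by (simp add: has_real_derivative_iff_has_vector_derivative)
    then show ?thesis
    proof (rule DERIV_local_max)
      show "0 < min t (2 - t)" using t by simp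
      show "\<forall>s. \<bar>t - s\<bar> < min t (2 - t) \<longrightarrow> k \<bullet> \<gamma> s \<le> k \<bullet> \<gamma> t"
      proof (intro allI impI)
        fix s assume "\<bar>t - s\<bar> < min t (2 - t)"
        then have "\<gamma> s \<in> D" by (intro rng) auto
        then show "k \<bullet> \<gamma> s \<le> k \<bullet> \<gamma> t" using k t by (auto simp: inner_diff_right)
      qed
    qed
  qed
  have mw: "m \<bullet> w = 0" and nw: "n \<bullet> w = 0" using perp m n by auto
  have w2: "w$1 \<noteq> 0 \<or> w$2 \<noteq> 0" using w0 by (auto simp: vec_eq_iff forall_2)
  have m1: "m$1 * m$1 + m$2 * m$2 = 1" and n1: "n$1 * n$1 + n$2 * n$2 = 1"
    using m n by (auto simp: norm_eq_1 inner_vec_def sum_2)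
  have mw': "m$1 * w$1 + m$2 * w$2 = 0" and nw': "n$1 * w$1 + n$2 * w$2 = 0"
    using mw nw by (auto simp: inner_vec_def sum_2)
  have det: "m$1 * n$2 = m$2 * n$1"
  proof -
    have "w$1 * (m$1 * n$2 - m$2 * n$1) =
        n$2 * (m$1 * w$1 + m$2 * w$2) - m$2 * (n$1 * w$1 + n$2 * w$2)"
      "w$2 * (m$1 * n$2 - m$2 * n$1) =
        m$1 * (n$1 * w$1 + n$2 * w$2) - n$1 * (m$1 * w$1 + m$2 * w$2)"
      by (simp_all add: algebra_simps)
    then have "w$1 * (m$1 * n$2 - m$2 * n$1) = 0" "w$2 * (m$1 * n$2 - m$2 * n$1) = 0"
      unfolding mw' nw' by simp_all
    then show ?thesis using w2 by auto
  qed
  have mn: "m = (m \<bullet> n) *\<^sub>R n"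
  proof -
    have "(m$1 * n$1 + m$2 * n$2) * n$1 =
        m$1 * (n$1 * n$1 + n$2 * n$2) - n$2 * (m$1 * n$2 - m$2 * n$1)"
      "(m$1 * n$1 + m$2 * n$2) * n$2 =
        m$2 * (n$1 * n$1 + n$2 * n$2) + n$1 * (m$1 * n$2 - m$2 * n$1)"
      by (simp_all add: algebra_simps)
    then have "m$1 = (m$1 * n$1 + m$2 * n$2) * n$1" "m$2 = (m$1 * n$1 + m$2 * n$2) * n$2"
      unfolding n1 using det by simp_all
    then show ?thesis by (simp add: vec_eq_iff forall_2 inner_vec_def sum_2)
  qed
  have "norm m = \<bar>m \<bullet> n\<bar> * norm n" by (subst mn) (rule norm_scaleR)
  then have "\<bar>m \<bullet> n\<bar> = 1" using m n by (metis mult.right_neutral)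
  moreover have "m \<bullet> n \<noteq> -1"
  proof
    assume "m \<bullet> n = -1"
    then have mm: "m = - n" using mn by (metis scaleR_minus1_left)
    obtain z where z: "z \<in> interior D" using ne by blast
    then obtain e where e: "e > 0" "ball z e \<subseteq> D"
      using mem_interior by blast
    have zz: "n \<bullet> (y - x) = 0" if "y \<in> D" for y
    proof -
      have "n \<bullet> (y - x) \<le> 0" "m \<bullet> (y - x) \<le> 0" using m n that by auto
      then show ?thesis using mm by simp
    qed
    have "z \<in> D" using e by (simp add: subset_iff)
    moreover have "z + (e/2) *\<^sub>R n \<in> D"
      using e n by (intro subsetD[OF e(2)]) (simp add: dist_norm)
    ultimately have "n \<bullet> (z - x) = 0" "n \<bullet> (z + (e/2) *\<^sub>R n - x) = 0"
      using zz by blast+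
    then have "(e/2) * (n \<bullet> n) = 0" by (simp add: inner_diff_right inner_add_right)
    then show False using e n by (auto simp: norm_eq_1)
  qed
  ultimately have "m \<bullet> n = 1" by linarith
  then show "m = n" using mn by (metis scaleR_one)
qed

definition billiard_trajectory ::
  "(real^2) set \<Rightarrow> (real^2) set \<Rightarrow> (int \<Rightarrow> real^2) \<Rightarrow> (int \<Rightarrow> real^2) \<Rightarrow> bool" where
  "billiard_trajectory K T q p \<longleftrightarrow>
     (\<forall>k. q k \<in> frontier K \<and> p k \<in> frontier T \<and>
        (\<exists>c>0. q (k + 1) - q k = c *\<^sub>R (- outer_normal T (p k))) \<and>
        (\<exists>c>0. p (k + 1) - p k = c *\<^sub>R outer_normal K (q (k + 1))))"

text \<open>The \<open>T\<close>-billiard trajectories in \<open>K\<close> and the \<open>K\<close>-billiard trajectories in \<open>T\<close>.\<close>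

definition q_trajectories :: "(real^2) set \<Rightarrow> (real^2) set \<Rightarrow> (int \<Rightarrow> real^2) set" where
  "q_trajectories K T = {q. \<exists>p. billiard_trajectory K T q p}"

definition p_trajectories :: "(real^2) set \<Rightarrow> (real^2) set \<Rightarrow> (int \<Rightarrow> real^2) set" where
  "p_trajectories K T = {p. \<exists>q. billiard_trajectory K T q p}"

definition tangent_line :: "(real^2) set \<Rightarrow> (real^2) set \<Rightarrow> bool" where
  "tangent_line l C \<longleftrightarrow> l \<inter> C \<noteq> {} \<and>
     (\<exists>n c. n \<noteq> 0 \<and> l = {x. n \<bullet> x = c} \<and> C \<subseteq> {x. n \<bullet> x \<le> c})"

definition segment_line :: "(int \<Rightarrow> real^2) \<Rightarrow> int \<Rightarrow> (real^2) set" where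
  "segment_line q k = affine hull {q k, q (k + 1)}"

definition tangent_trajectory :: "(int \<Rightarrow> real^2) \<Rightarrow> (real^2) set \<Rightarrow> bool" where
  "tangent_trajectory q C \<longleftrightarrow> (\<forall>k. tangent_line (segment_line q k) C)"

definition convex_caustic :: "(int \<Rightarrow> real^2) set \<Rightarrow> (real^2) set \<Rightarrow> (real^2) set \<Rightarrow> bool" where
  "convex_caustic \<T> D C \<longleftrightarrow>
     C \<noteq> {} \<and> compact C \<and> convex C \<and> C \<subseteq> interior D \<and>
     (\<forall>q\<in>\<T>. (\<exists>k. tangent_line (segment_line q k) C) \<longrightarrow> tangent_trajectory q C)"

definition convex_T_caustic :: "(real^2) set \<Rightarrow> (real^2) set \<Rightarrow> (real^2) set \<Rightarrow> bool" where
  "convex_T_caustic K T C \<longleftrightarrow> convex_caustic (q_trajectories K T) K C"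

definition convex_K_caustic :: "(real^2) set \<Rightarrow> (real^2) set \<Rightarrow> (real^2) set \<Rightarrow> bool" where
  "convex_K_caustic K T C' \<longleftrightarrow> convex_caustic (p_trajectories K T) T C'"

definition smooth_strictly_convex_T_caustic ::
  "(real^2) set \<Rightarrow> (real^2) set \<Rightarrow> (real^2) set \<Rightarrow> bool" where
  "smooth_strictly_convex_T_caustic K T C \<longleftrightarrow>
     convex_T_caustic K T C \<and> strictly_convex_body C \<and> C1_smooth_boundary C"

definition dual_caustics ::
  "(real^2) set \<Rightarrow> (real^2) set \<Rightarrow> (real^2) set \<Rightarrow> (real^2) set \<Rightarrow> bool" where
  "dual_caustics K T C C' \<longleftrightarrow>
     convex_T_caustic K T C \<and> convex_K_caustic K T C' \<and>
     (\<forall>q p. billiard_trajectory K T q p \<longrightarrow>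
        (tangent_trajectory q C \<longleftrightarrow> tangent_trajectory p C'))"

end

theory Submission
  imports Defs
begin

text \<open>
  Let \<open>K\<close> be the unit disk and \<open>C\<close> a smaller concentric disk. A chord of \<open>K\<close> that touches
  \<open>C\<close> and has normal direction \<open>\<psi>\<close> joins the boundary points with polar angles
  \<open>\<psi> - \<beta>\<close> and \<open>\<psi> + \<beta>\<close>, where \<open>\<plusminus>cos \<beta>\<close> is the radius of \<open>C\<close>; so \<open>C\<close> is a
  \<open>T\<close>-caustic as soon as the \<open>T\<close>-reflection turns every such chord by \<open>2\<beta>\<close>. In terms of the
  boundary point \<open>P(t)\<close> of \<open>T\<close> with outer normal direction \<open>t\<close> this says that
  \<open>P(\<tau> + \<beta>) - P(\<tau> - \<beta>)\<close> is orthogonal to the direction \<open>\<tau>\<close> for every \<open>\<tau>\<close>. The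
  condition is linear in the support function \<open>h\<close> of \<open>T\<close>. It holds for constants, and for
  the Fourier mode \<open>cos n t\<close> exactly when \<open>tan (n\<beta>) = n tan \<beta>\<close>, the equation that Gutkin
  found for billiard tables with constant angle. For \<open>n = 4\<close>, an even number, as central
  symmetry demands, it has the solution \<open>tan\<^sup>2 \<beta> = 5\<close>, that is \<open>cos\<^sup>2 \<beta> = 1/6\<close>.

  The segments of the dual trajectories are the chords from \<open>P(\<tau> - \<beta>)\<close> to \<open>P(\<tau> + \<beta>)\<close>, with
  normal direction \<open>\<tau>\<close>. For \<open>h = a + b cos 4t\<close> the signed distance of such a chord from the
  origin is \<open>cos \<beta> (a - 9 b cos 4\<tau>)\<close>: the oscillating part is amplified by \<open>9\<close>. The number
  \<open>h + h''\<close> is the radius of curvature, so \<open>T\<close> is smooth and strictly convex if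
  \<open>15 \<bar>b\<bar> < a\<close>, whereas \<open>a - 9 b cos 4\<tau>\<close> is the support function of a convex set only if
  \<open>135 \<bar>b\<bar> \<le> a\<close>. Between these bounds \<open>C\<close> is a caustic without a convex dual.

  The choice here is \<open>h = 18 + cos 4t\<close>. The chords are then at distance \<open>9 cos \<beta>\<close> from the origin
  for the directions \<open>0\<close> and \<open>\<pi>/2\<close>, but at distance \<open>27 cos \<beta>\<close> for the direction \<open>\<pi>/4\<close>. A
  set in the quadrant \<open>x, y \<le> 9 cos \<beta>\<close> cannot touch the last one
  (\<open>no_dual_caustic\<close>). The two facts about \<open>T\<close> that carry the proof are
  \<open>oval_point_diff\<close> and \<open>oval_point_coordinates\<close>.
\<close>

section \<open>Directions and lines in the plane\<close>

definition dir :: "real \<Rightarrow> real^2" where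
  "dir t = vector [cos t, sin t]"

lemma inner_dir: "dir t \<bullet> x = cos t * x$1 + sin t * x$2"
  by (simp add: dir_def inner_vec_def sum_2)

lemma inner_dir_dir: "dir s \<bullet> dir t = cos (s - t)"
  by (simp add: inner_dir cos_diff) (simp add: dir_def)

lemma norm_dir [simp]: "norm (dir t) = 1"
  by (simp add: norm_eq_1 inner_dir_dir)

lemma dir_nonzero [simp]: "dir t \<noteq> 0"
  using norm_dir[of t] by force

lemma dir_orthogonal [simp]: "dir t \<bullet> dir (t + pi/2) = 0" "dir (t + pi/2) \<bullet> dir t = 0"
  by (simp_all add: inner_dir_dir)

lemma dir_add_pi: "dir (t + pi) = - dir t"
  by (simp add: dir_def vec_eq_iff forall_2)

lemma dir_add_half_pi: "dir (t + pi/2) = vector [- sin t, cos t]"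
  by (simp add: dir_def cos_add sin_add)

lemma dir_periodic: "dir (t + 2 * pi) = dir t"
  by (simp add: dir_def)

lemma dir_diff: "dir (t + b) - dir (t - b) = (2 * sin b) *\<^sub>R dir (t + pi/2)"
  unfolding dir_add_half_pi
  by (simp add: dir_def vec_eq_iff forall_2 cos_add cos_diff sin_add sin_diff)

lemma dir_decomposition: "x = (dir t \<bullet> x) *\<^sub>R dir t + (dir (t + pi/2) \<bullet> x) *\<^sub>R dir (t + pi/2)"
proof -
  have "x$1 = (cos t * x$1 + sin t * x$2) * cos t + (- sin t * x$1 + cos t * x$2) * (- sin t)"
       "x$2 = (cos t * x$1 + sin t * x$2) * sin t + (- sin t * x$1 + cos t * x$2) * cos t"
    using sin_cos_squared_add[of t] by algebra+
  then show ?thesis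
    unfolding inner_dir dir_add_half_pi
    by (simp add: dir_def vec_eq_iff forall_2 inner_vec_def sum_2 cos_add sin_add)
qed

lemma dir_coordinates_eqI:
  assumes "dir t \<bullet> x = dir t \<bullet> y" "dir (t + pi/2) \<bullet> x = dir (t + pi/2) \<bullet> y"
  shows "x = y"
  using dir_decomposition[of x t] dir_decomposition[of y t] assms by metis

lemma dir_polar: "\<exists>t. x = norm x *\<^sub>R dir t"
proof (cases "x = 0")
  case False
  have "norm x ^ 2 = (x$1)^2 + (x$2)^2"
    unfolding power2_norm_eq_inner by (simp add: inner_vec_def sum_2 power2_eq_square)
  then have "(x$1 / norm x)^2 + (x$2 / norm x)^2 = 1"
    using False by (simp only: power_divide add_divide_distrib[symmetric]) (metis divide_self norm_eq_zero power_not_zero)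
  then obtain t where "x$1 / norm x = cos t" "x$2 / norm x = sin t"
    using sincos_total_2pi by metis
  then have "x$1 = norm x * cos t" "x$2 = norm x * sin t"
    using False by (metis mult.commute nonzero_divide_eq_eq norm_eq_zero)+
  then have "x = norm x *\<^sub>R dir t"
    by (simp only: vec_eq_iff forall_2) (simp add: dir_def)
  then show ?thesis ..
qed auto

lemma dir_eqD: "dir s = dir t \<Longrightarrow> cos (s - t) = 1"
  by (metis inner_dir_dir norm_dir norm_eq_1)

lemma cos_diff_1_imp_dir_eq:
  assumes "cos (s - t) = 1" shows "dir s = dir t"
proof -
  obtain n :: int where "s - t = real_of_int n * 2 * pi"
    using assms cos_one_2pi_int by auto
  then have "s = t + 2 * pi * n" by (simp add: algebra_simps)
  then show ?thesis by (simp add: dir_def cos_add sin_add)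
qed

lemma dir_has_vector_derivative: "(dir has_vector_derivative dir (t + pi/2)) (at t)"
  unfolding has_vector_derivative_def
proof (subst has_derivative_componentwise_within, intro ballI)
  fix i :: "real^2" assume "i \<in> Basis"
  then obtain j :: 2 where i: "i = axis j 1" by (auto simp: Basis_vec_def)
  have "((\<lambda>x. dir x $ j) has_derivative (\<lambda>x. x * dir (t + pi/2) $ j)) (at t)"
    using exhaust_2[of j] unfolding dir_add_half_pi
    by (auto simp: dir_def intro!: derivative_eq_intros)
  then show "((\<lambda>x. dir x \<bullet> i) has_derivative (\<lambda>x. (x *\<^sub>R dir (t + pi/2)) \<bullet> i)) (at t)"
    unfolding i by (simp add: inner_axis)
qed

lemma continuous_on_dir:
  assumes "continuous_on S f" shows "continuous_on S (\<lambda>x. dir (f x))"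
proof -
  have "continuous_on (f ` S) dir"
    using dir_has_vector_derivative has_vector_derivative_continuous
    by (intro continuous_at_imp_continuous_on) blast
  then show ?thesis using assms continuous_on_compose2 by blast
qed

lemma affine_hull_2_eq_line:
  assumes "dir t \<bullet> x = c" "dir t \<bullet> y = c" "x \<noteq> y"
  shows "affine hull {x, y} = {z. dir t \<bullet> z = c}"
proof (intro equalityI subsetI)
  fix z assume "z \<in> affine hull {x, y}"
  then obtain u v where "u + v = 1" "z = u *\<^sub>R x + v *\<^sub>R y"
    unfolding affine_hull_2 by auto
  then show "z \<in> {z. dir t \<bullet> z = c}"
    using assms(1,2) by (simp add: inner_add_right flip: distrib_right)
next
  fix z assume "z \<in> {z. dir t \<bullet> z = c}"
  then have z: "dir t \<bullet> z = c" by simp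
  define f where "f w = dir (t + pi/2) \<bullet> w" for w
  have ne: "f x \<noteq> f y"
    using dir_coordinates_eqI[of t x y] assms unfolding f_def by auto
  define v where "v = (f z - f x) / (f y - f x)"
  have "z = (1 - v) *\<^sub>R x + v *\<^sub>R y"
  proof (rule dir_coordinates_eqI[of t])
    show "dir t \<bullet> z = dir t \<bullet> ((1 - v) *\<^sub>R x + v *\<^sub>R y)"
      using z assms by (simp add: inner_add_right algebra_simps)
    have "v * (f y - f x) = f z - f x" using ne by (simp add: v_def)
    then have "f z = (1 - v) * f x + v * f y" by (simp add: algebra_simps)
    then show "dir (t + pi/2) \<bullet> z = dir (t + pi/2) \<bullet> ((1 - v) *\<^sub>R x + v *\<^sub>R y)"
      unfolding f_def by (simp add: inner_add_right)
  qed
  then show "z \<in> affine hull {x, y}"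
    unfolding affine_hull_2 by (intro CollectI exI[of _ "1 - v"] exI[of _ v]) simp
qed

text \<open>
  A line determines its unit normal and offset up to a common sign. The sign matters
  because tangency leaves open on which side of the line the set lies.
\<close>

lemma line_dir_unique:
  assumes "{x. dir s \<bullet> x = c} = {x. dir t \<bullet> x = d}"
  shows "(dir t = dir s \<and> d = c) \<or> (dir t = - dir s \<and> d = - c)"
proof -
  have "c *\<^sub>R dir s + k *\<^sub>R dir (s + pi/2) \<in> {x. dir t \<bullet> x = d}" for k
    unfolding assms[symmetric] by (simp add: inner_add_right inner_dir_dir)
  then have k: "c * (dir t \<bullet> dir s) + k * (dir t \<bullet> dir (s + pi/2)) = d" for k
    by (simp add: inner_add_right)
  have o: "dir t \<bullet> dir (s + pi/2) = 0" and d: "d = c * (dir t \<bullet> dir s)"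
    using k[of 0] k[of 1] by auto
  have eq: "dir t = (dir t \<bullet> dir s) *\<^sub>R dir s"
    using dir_decomposition[of "dir t" s] o by (simp add: inner_commute)
  have "\<bar>dir t \<bullet> dir s\<bar> = 1"
    using arg_cong[OF eq, of norm] by simp
  then consider "dir t \<bullet> dir s = 1" | "dir t \<bullet> dir s = -1" by linarith
  then show ?thesis using eq d by cases auto
qed

lemma tangent_lineI:
  assumes "n \<noteq> 0" "x \<in> C" "n \<bullet> x = c" "\<And>y. y \<in> C \<Longrightarrow> n \<bullet> y \<le> c"
  shows "tangent_line {x. n \<bullet> x = c} C"
proof -
  have "x \<in> {x. n \<bullet> x = c} \<inter> C" "C \<subseteq> {x. n \<bullet> x \<le> c}" using assms by simp_all blast
  then show ?thesis unfolding tangent_line_def using assms(1) by blast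
qed

lemma tangent_line_dirE:
  assumes "tangent_line l C"
  obtains t c where "l = {x. dir t \<bullet> x = c}" "C \<subseteq> {x. dir t \<bullet> x \<le> c}" "l \<inter> C \<noteq> {}"
proof -
  obtain n c where n: "n \<noteq> 0" "l = {x. n \<bullet> x = c}" "C \<subseteq> {x. n \<bullet> x \<le> c}" and ne: "l \<inter> C \<noteq> {}"
    using assms unfolding tangent_line_def by blast
  obtain t where t: "n = norm n *\<^sub>R dir t" using dir_polar by blast
  define N where "N = norm n"
  have N: "N > 0" using n N_def by simp
  have i: "n \<bullet> x = N * (dir t \<bullet> x)" for x by (subst t) (simp add: N_def)
  have l: "l = {x. dir t \<bullet> x = c / N}" using n(2) N by (auto simp: i field_simps)
  moreover have "C \<subseteq> {x. dir t \<bullet> x \<le> c / N}" using n(3) N by (auto simp: i field_simps)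
  ultimately show thesis using that ne by blast
qed

section \<open>Ovals with support function \<open>a + b cos 4t\<close>\<close>

definition oval_support :: "real \<Rightarrow> real \<Rightarrow> real \<Rightarrow> real" where
  "oval_support a b t = a + b * cos (4 * t)"

definition oval :: "real \<Rightarrow> real \<Rightarrow> (real^2) set" where
  "oval a b = {x. \<forall>t. dir t \<bullet> x \<le> oval_support a b t}"

text \<open>The boundary point with outer normal \<open>t\<close>: position \<open>h(t)\<close> along the normal and \<open>h'(t)\<close> along
  the tangent direction.\<close>

definition oval_point :: "real \<Rightarrow> real \<Rightarrow> real \<Rightarrow> real^2" where
  "oval_point a b t = oval_support a b t *\<^sub>R dir t + (- 4 * b * sin (4 * t)) *\<^sub>R dir (t + pi/2)"

lemma oval_le: "x \<in> oval a b \<Longrightarrow> dir t \<bullet> x \<le> oval_support a b t"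
  by (simp add: oval_def)

lemma inner_dir_oval_point:
  "dir s \<bullet> oval_point a b t = oval_support a b t * cos (s - t) - 4 * b * sin (4 * t) * sin (s - t)"
proof -
  have "cos (s - (t + pi/2)) = sin (s - t)"
    by (simp add: cos_diff cos_add sin_add sin_diff)
  then show ?thesis
    by (simp add: oval_point_def inner_add_right inner_diff_right inner_dir_dir)
qed

lemma inner_dir_oval_point_same [simp]: "dir t \<bullet> oval_point a b t = oval_support a b t"
  by (simp add: inner_dir_oval_point)

lemma oval_point_cong:
  assumes "dir s = dir t" shows "oval_point a b s = oval_point a b t"
proof -
  obtain n :: int where "s - t = real_of_int n * 2 * pi"
    using dir_eqD[OF assms] cos_one_2pi_int by auto
  then have s: "s = t + 2 * pi * n" by (simp add: algebra_simps)
  have "4 * s = 4 * t + 2 * pi * real_of_int (4 * n)" unfolding s by simp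
  then have "cos (4 * s) = cos (4 * t)" "sin (4 * s) = sin (4 * t)"
    by (simp_all only: cos_add sin_add cos_int_2pin sin_int_2pin mult_1_right mult_zero_right
        diff_zero add.right_neutral)
  moreover have "dir (s + pi/2) = dir (t + pi/2)"
    by (rule cos_diff_1_imp_dir_eq) (use dir_eqD[OF assms] in simp)
  ultimately show ?thesis using assms by (simp add: oval_point_def oval_support_def)
qed

lemma oval_point_disk: "oval_point r 0 t = r *\<^sub>R dir t"
  by (simp add: oval_point_def oval_support_def)

lemma quadruple_angle:
  "cos (4 * d) = 8 * cos d ^ 4 - 8 * cos d ^ 2 + (1::real)"
  "sin (4 * d) = sin d * (8 * cos d ^ 3 - 4 * cos d :: real)"
proof -
  have "cos (4 * d) = 2 * (cos (2 * d))\<^sup>2 - 1" "sin (4 * d) = 2 * sin (2 * d) * cos (2 * d)"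
    using cos_double_cos[of "2 * d"] sin_double[of "2 * d"] by simp_all
  then show "cos (4 * d) = 8 * cos d ^ 4 - 8 * cos d ^ 2 + (1::real)"
    "sin (4 * d) = sin d * (8 * cos d ^ 3 - 4 * cos d :: real)"
    unfolding cos_double_cos sin_double by algebra+
qed

text \<open>
  This is the inequality behind \<open>oval_support_gap\<close> for the mode \<open>cos 4t\<close> alone. The constant \<open>15\<close>
  is optimal, as \<open>1 - 4\<^sup>2 = - 15\<close> is the factor of \<open>cos 4t\<close> in \<open>h + h''\<close>. By Cauchy's inequality
  the left-hand side is at most the square root of \<open>A\<^sup>2 + B\<^sup>2\<close>, where \<open>A\<close> and \<open>B\<close> depend on
  \<open>d = s - t\<close> only. In \<open>x = cos d\<close> this sum is \<open>(1 - x)\<^sup>2\<close> times a cubic polynomial with positive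
  coefficients; on \<open>[-1, 1]\<close> this is largest at \<open>x = 1\<close>, with value \<open>15\<^sup>2\<close>.
\<close>

lemma oval_support_gap_bound:
  "\<bar>cos (4 * s) - cos (4 * t) * cos (s - t) + 4 * sin (4 * t) * sin (s - t)\<bar> \<le> 15 * (1 - cos (s - t :: real))"
proof -
  define d where "d = s - t"
  define A where "A = cos (4 * d) - cos d"
  define B where "B = 4 * sin d - sin (4 * d)"
  have s4: "cos (4 * s) = cos (4 * t) * cos (4 * d) - sin (4 * t) * sin (4 * d)"
    by (simp add: d_def flip: cos_add)
  have eq: "cos (4 * s) - cos (4 * t) * cos d + 4 * sin (4 * t) * sin d
      = cos (4 * t) * A + sin (4 * t) * B"
    unfolding s4 A_def B_def by algebra
  define x where "x = cos d"
  have x: "-1 \<le> x" "x \<le> 1" by (simp_all add: x_def)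
  have "(sin d)^2 = 1 - x^2" by (simp add: x_def sin_squared_eq)
  then have AB: "A^2 + B^2 = (1 - x)^2 * (48 * x^3 + 96 * x^2 + 64 * x + 17)"
    unfolding A_def B_def quadruple_angle x_def[symmetric] by algebra
  have "x^2 \<le> 1" using x by (simp add: abs_square_le_1 abs_le_iff)
  moreover have "x^3 \<le> 1"
  proof -
    have "x^2 * x \<le> x^2 * 1" by (rule mult_left_mono) (use x in auto)
    then show ?thesis using \<open>x^2 \<le> 1\<close> by (simp add: power3_eq_cube power2_eq_square)
  qed
  ultimately have "48 * x^3 + 96 * x^2 + 64 * x + 17 \<le> 15^2" using x by simp
  then have AB': "A^2 + B^2 \<le> (15 * (1 - x))^2"
    unfolding AB power_mult_distrib
    by (metis mult.commute mult_left_mono zero_le_power2)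
  have "(cos (4 * t) * A + sin (4 * t) * B)^2 \<le> A^2 + B^2"
  proof -
    have "(cos (4 * t) * A + sin (4 * t) * B)^2 + (cos (4 * t) * B - sin (4 * t) * A)^2 = A^2 + B^2"
      using sin_cos_squared_add[of "4 * t"] by algebra
    then show ?thesis by (metis le_add_same_cancel1 zero_le_power2)
  qed
  then have "(cos (4 * t) * A + sin (4 * t) * B)^2 \<le> (15 * (1 - x))^2"
    using AB' by (rule order_trans)
  then have "\<bar>cos (4 * t) * A + sin (4 * t) * B\<bar> \<le> \<bar>15 * (1 - x)\<bar>"
    by (simp only: abs_le_square_iff)
  also have "\<dots> = 15 * (1 - x)" using x by simp
  finally have "\<bar>cos (4 * t) * A + sin (4 * t) * B\<bar> \<le> 15 * (1 - x)" .
  then show ?thesis using eq by (simp add: d_def x_def)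
qed

context
  fixes a b :: real
  assumes ab: "15 * \<bar>b\<bar> < a"
begin

text \<open>
  A quantitative form of strict convexity: \<open>P(t)\<close> stays strictly inside the supporting half-plane
  of every other direction. It shows both that the curve lies in the oval and that different
  directions have different contact points.
\<close>

lemma oval_support_gap:
  "(a - 15 * \<bar>b\<bar>) * (1 - cos (s - t)) \<le> oval_support a b s - dir s \<bullet> oval_point a b t"
proof -
  define g where "g = cos (4 * s) - cos (4 * t) * cos (s - t) + 4 * sin (4 * t) * sin (s - t)"
  have "oval_support a b s - dir s \<bullet> oval_point a b t = a * (1 - cos (s - t)) + b * g"
    unfolding g_def inner_dir_oval_point oval_support_def by (simp add: algebra_simps)
  moreover have "\<bar>b * g\<bar> \<le> \<bar>b\<bar> * (15 * (1 - cos (s - t)))"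
    unfolding abs_mult g_def by (intro mult_left_mono oval_support_gap_bound) auto
  ultimately show ?thesis by (simp add: algebra_simps abs_le_iff)
qed

lemma oval_point_in_oval: "oval_point a b t \<in> oval a b"
proof -
  have "0 \<le> oval_support a b s - dir s \<bullet> oval_point a b t" for s
    by (rule order_trans[OF _ oval_support_gap]) (use ab in simp)
  then show ?thesis by (simp add: oval_def)
qed

text \<open>
  For a point \<open>x\<close> of the oval the gap \<open>h(s) - \<langle>dir s, x\<rangle>\<close> is nonnegative; where it vanishes it is
  minimal, so its derivative vanishes too, which fixes the second coordinate of \<open>x\<close>.
\<close>

lemma oval_contact_unique:
  assumes "x \<in> oval a b" "dir t \<bullet> x = oval_support a b t"
  shows "x = oval_point a b t"
proof (rule dir_coordinates_eqI[of t])
  show "dir t \<bullet> x = dir t \<bullet> oval_point a b t" using assms by simp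
  have "((\<lambda>s. oval_support a b s - dir s \<bullet> x) has_real_derivative
          (- 4 * b * sin (4 * t)) - dir (t + pi/2) \<bullet> x) (at t)"
    unfolding oval_support_def inner_dir
    by (auto intro!: derivative_eq_intros simp: cos_add sin_add algebra_simps)
  then have "(- 4 * b * sin (4 * t)) - dir (t + pi/2) \<bullet> x = 0"
    by (rule DERIV_local_min[where d = 1]) (use assms in \<open>auto simp: oval_def\<close>)
  then show "dir (t + pi/2) \<bullet> x = dir (t + pi/2) \<bullet> oval_point a b t"
    by (simp add: inner_dir_oval_point)
qed

lemma oval_interior:
  assumes "\<And>t. dir t \<bullet> x < oval_support a b t"
  shows "x \<in> interior (oval a b)"
proof -
  have "continuous_on {0..2*pi} (\<lambda>t. oval_support a b t - dir t \<bullet> x)"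
    unfolding oval_support_def inner_dir by (intro continuous_intros)
  then obtain t0 where t0: "\<And>t. t \<in> {0..2*pi} \<Longrightarrow>
      oval_support a b t0 - dir t0 \<bullet> x \<le> oval_support a b t - dir t \<bullet> x"
    using continuous_attains_inf[of "{0..2*pi}"] by fastforce
  define m where "m = oval_support a b t0 - dir t0 \<bullet> x"
  have "m > 0" using assms by (simp add: m_def)
  have m: "dir t \<bullet> x + m \<le> oval_support a b t" for t
  proof -
    \<comment> \<open>the minimum over one period is the minimum over all directions\<close>
    obtain s where s: "s \<in> {0..2*pi}" "cos t = cos s" "sin t = sin s"
      using sincos_total_2pi_le[of "cos t" "sin t"] by auto
    have "dir t = dir s" using s by (simp add: dir_def)
    moreover have "oval_support a b t = oval_support a b s"
      using s by (simp add: oval_support_def quadruple_angle)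
    ultimately show ?thesis using t0[OF s(1)] by (simp add: m_def)
  qed
  have "ball x m \<subseteq> oval a b"
  proof
    fix y assume "y \<in> ball x m"
    then have ym: "norm (y - x) < m" by (simp add: dist_norm norm_minus_commute)
    have "dir t \<bullet> y \<le> oval_support a b t" for t
      using norm_cauchy_schwarz[of "dir t" "y - x"] ym m[of t] by (simp add: inner_diff_right)
    then show "y \<in> oval a b" by (simp add: oval_def)
  qed
  then show ?thesis using \<open>m > 0\<close> mem_interior by blast
qed

lemma oval_not_interior:
  assumes "dir t \<bullet> x = oval_support a b t"
  shows "x \<notin> interior (oval a b)"
proof
  assume "x \<in> interior (oval a b)"
  then obtain d where d: "d > 0" "ball x d \<subseteq> oval a b" using mem_interior by blast
  have "x + (d/2) *\<^sub>R dir t \<in> oval a b"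
    using d by (intro subsetD[OF d(2)]) (simp add: dist_norm)
  then have "dir t \<bullet> (x + (d/2) *\<^sub>R dir t) \<le> oval_support a b t" by (simp add: oval_def)
  then show False using assms d by (simp add: inner_add_right inner_dir_dir)
qed

lemma closed_oval: "closed (oval a b)" and convex_oval: "convex (oval a b)"
proof -
  have "oval a b = (\<Inter>t. {x. dir t \<bullet> x \<le> oval_support a b t})" by (auto simp: oval_def)
  then show "closed (oval a b)" "convex (oval a b)"
    by (auto intro!: closed_INT convex_INT closed_halfspace_le convex_halfspace_le)
qed

lemma oval_support_pos: "oval_support a b t > 0"
proof -
  have "\<bar>b * cos (4 * t)\<bar> \<le> \<bar>b\<bar> * 1" unfolding abs_mult by (intro mult_left_mono) auto
  then show ?thesis using ab unfolding oval_support_def by linarith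
qed

lemma frontier_oval: "frontier (oval a b) = range (oval_point a b)"
proof (intro equalityI subsetI)
  fix x assume "x \<in> frontier (oval a b)"
  then have x: "x \<in> oval a b" "x \<notin> interior (oval a b)"
    using closed_oval by (auto simp: frontier_def)
  then obtain t where "\<not> dir t \<bullet> x < oval_support a b t" using oval_interior by blast
  then have "dir t \<bullet> x = oval_support a b t" using x(1) by (simp add: oval_def order_antisym)
  then show "x \<in> range (oval_point a b)" using oval_contact_unique x(1) by blast
next
  fix x assume "x \<in> range (oval_point a b)"
  then obtain t where "x = oval_point a b t" by blast
  then show "x \<in> frontier (oval a b)"
    using oval_point_in_oval oval_not_interior[of t] closed_oval by (auto simp: frontier_def)
qed

lemma oval_strictly_convex_body: "strictly_convex_body (oval a b)"
proof -
  have "bounded (oval a b)"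
  proof (rule boundedI)
    fix x assume "x \<in> oval a b"
    obtain t where t: "x = norm x *\<^sub>R dir t" using dir_polar by blast
    have "norm x = dir t \<bullet> x" by (subst (2) t) (simp add: inner_dir_dir)
    also have "\<dots> \<le> oval_support a b t" using \<open>x \<in> oval a b\<close> by (simp add: oval_def)
    also have "\<dots> \<le> a + \<bar>b\<bar>"
    proof -
      have "\<bar>b * cos (4 * t)\<bar> \<le> \<bar>b\<bar> * 1" unfolding abs_mult by (intro mult_left_mono) auto
      then show ?thesis unfolding oval_support_def by linarith
    qed
    finally show "norm x \<le> a + \<bar>b\<bar>" .
  qed
  moreover have "0 \<in> interior (oval a b)" by (intro oval_interior) (simp add: oval_support_pos)
  moreover have "\<not> closed_segment x y \<subseteq> frontier (oval a b)" if "x \<noteq> y" for x y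
  proof
    assume sub: "closed_segment x y \<subseteq> frontier (oval a b)"
    then have xy: "x \<in> oval a b" "y \<in> oval a b"
      using closed_oval frontier_subset_closed by (metis ends_in_segment subsetD)+
    have "midpoint x y \<in> frontier (oval a b)" using sub midpoint_in_closed_segment by blast
    then obtain t where t: "midpoint x y = oval_point a b t" unfolding frontier_oval by blast
    have "dir t \<bullet> x + dir t \<bullet> y = 2 * (dir t \<bullet> midpoint x y)"
      by (simp add: midpoint_def inner_add_right)
    then have "dir t \<bullet> x = oval_support a b t" "dir t \<bullet> y = oval_support a b t"
      using oval_le[OF xy(1), of t] oval_le[OF xy(2), of t] by (simp_all add: t)
    then have "x = y" using oval_contact_unique xy by metis
    then show False using that by simp
  qed
  ultimately show ?thesis
    unfolding strictly_convex_body_def convex_body_def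
    using closed_oval convex_oval by (auto simp: compact_eq_bounded_closed)
qed

lemma oval_point_eqD:
  assumes "oval_point a b s = oval_point a b t" shows "dir s = dir t"
proof -
  have "dir s \<bullet> oval_point a b t = oval_support a b s" using assms[symmetric] by simp
  then have "(a - 15 * \<bar>b\<bar>) * (1 - cos (s - t)) \<le> 0" using oval_support_gap[of s t] by simp
  then have "1 - cos (s - t) \<le> 0" using ab by (simp add: mult_le_0_iff)
  then have "cos (s - t) = 1" using cos_le_one[of "s - t"] by linarith
  then show ?thesis by (rule cos_diff_1_imp_dir_eq)
qed

text \<open>The factor is the radius of curvature \<open>h + h''\<close>; that it is positive makes the
  parametrization by the normal direction regular.\<close>

lemma oval_point_derivative:
  "(oval_point a b has_vector_derivative (a - 15 * b * cos (4 * t)) *\<^sub>R dir (t + pi/2)) (at t)"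
proof -
  have d2: "((\<lambda>t. dir (t + pi/2)) has_vector_derivative - dir t) (at t)" for t
  proof -
    have "dir (t + pi/2 + pi/2) = - dir t" using dir_add_pi[of t] unfolding add.assoc by simp
    moreover have "((\<lambda>t. t + pi/2) has_vector_derivative 1) (at t)"
      by (auto intro!: derivative_eq_intros)
    ultimately show ?thesis
      using vector_diff_chain_at[of "\<lambda>t. t + pi/2" 1 t dir] dir_has_vector_derivative[of "t + pi/2"]
      by (simp only: o_def scaleR_one)
  qed
  have "((\<lambda>t. oval_support a b t) has_real_derivative - 4 * b * sin (4 * t)) (at t)"
    "((\<lambda>t. - 4 * b * sin (4 * t)) has_real_derivative - 16 * b * cos (4 * t)) (at t)"
    unfolding oval_support_def by (auto intro!: derivative_eq_intros)
  then have "(oval_point a b has_vector_derivative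
      (oval_support a b t *\<^sub>R dir (t + pi/2) + (- 4 * b * sin (4 * t)) *\<^sub>R dir t)
      + ((- 4 * b * sin (4 * t)) *\<^sub>R (- dir t) + (- 16 * b * cos (4 * t)) *\<^sub>R dir (t + pi/2))) (at t)"
    unfolding oval_point_def
    by (intro has_vector_derivative_add has_vector_derivative_scaleR dir_has_vector_derivative d2)
  then show ?thesis
    by (rule has_vector_derivative_eq_rhs)
       (simp add: oval_support_def algebra_simps flip: scaleR_add_left scaleR_diff_left)
qed

lemma oval_C1_smooth_boundary: "C1_smooth_boundary (oval a b)"
proof -
  define \<gamma> where "\<gamma> t = oval_point a b (2 * pi * t)" for t
  define v where "v t = (2 * pi * (a - 15 * b * cos (4 * (2 * pi * t)))) *\<^sub>R dir (2 * pi * t + pi/2)" for t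
  have d: "(\<gamma> has_vector_derivative v t) (at t)" for t
  proof -
    have "((\<lambda>t. 2 * pi * t) has_vector_derivative 2 * pi) (at t)"
      by (auto intro!: derivative_eq_intros simp: has_real_derivative_iff_has_vector_derivative[symmetric])
    from vector_diff_chain_at[OF this oval_point_derivative] show ?thesis
      by (simp add: \<gamma>_def[abs_def] v_def o_def)
  qed
  have "continuous_on UNIV v"
    unfolding v_def by (intro continuous_intros continuous_on_dir)
  then have "\<gamma> C1_differentiable_on UNIV"
    using d unfolding C1_differentiable_on_def by blast
  moreover have "vector_derivative \<gamma> (at t) \<noteq> 0" for t
  proof -
    have "\<bar>b * cos (4 * (2 * pi * t))\<bar> \<le> \<bar>b\<bar> * 1"
      unfolding abs_mult by (intro mult_left_mono) auto
    then have "v t \<noteq> 0" using ab by (simp add: v_def)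
    then show ?thesis using vector_derivative_at[OF d] by simp
  qed
  moreover have per: "\<gamma> (t + 1) = \<gamma> t" for t
    unfolding \<gamma>_def by (rule oval_point_cong) (simp add: distrib_left dir_periodic)
  moreover have "inj_on \<gamma> {0..<1}"
  proof (rule inj_onI)
    fix s t :: real assume st: "s \<in> {0..<1}" "t \<in> {0..<1}" "\<gamma> s = \<gamma> t"
    then have "cos (2 * pi * s - 2 * pi * t) = 1"
      unfolding \<gamma>_def by (intro dir_eqD oval_point_eqD)
    then obtain n :: int where "2 * pi * s - 2 * pi * t = n * 2 * pi"
      using cos_one_2pi_int by auto
    then have "2 * pi * (s - t) = 2 * pi * n" by (simp add: algebra_simps)
    then have n: "s - t = n" by simp
    then have "\<bar>real_of_int n\<bar> < 1" using st by auto
    then have "n = 0" by linarith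
    then show "s = t" using n by simp
  qed
  moreover have "\<gamma> ` {0..<1} = frontier (oval a b)"
    unfolding frontier_oval
  proof (intro equalityI subsetI)
    fix x assume "x \<in> range (oval_point a b)"
    then obtain t where t: "x = oval_point a b t" by blast
    have "x = \<gamma> (frac (t / (2 * pi)))"
      unfolding t \<gamma>_def
    proof (intro oval_point_cong cos_diff_1_imp_dir_eq)
      have "t - 2 * pi * frac (t / (2 * pi)) = 2 * pi * \<lfloor>t / (2 * pi)\<rfloor>"
        by (simp add: frac_def field_simps)
      then show "cos (t - 2 * pi * frac (t / (2 * pi))) = 1" by (simp only: cos_int_2pin)
    qed
    moreover have "frac (t / (2 * pi)) \<in> {0..<1}" by (simp add: frac_lt_1)
    ultimately show "x \<in> \<gamma> ` {0..<1}" by blast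
  qed (auto simp: \<gamma>_def)
  ultimately show ?thesis unfolding C1_smooth_boundary_def by blast
qed

lemma outer_normal_oval: "outer_normal (oval a b) (oval_point a b t) = dir t"
proof -
  have "convex_body (oval a b)" using oval_strictly_convex_body by (simp add: strictly_convex_body_def)
  moreover have "oval_point a b t \<in> frontier (oval a b)" by (simp add: frontier_oval)
  ultimately have "\<exists>!n. norm n = 1 \<and> (\<forall>y\<in>oval a b. n \<bullet> (y - oval_point a b t) \<le> 0)"
    using oval_C1_smooth_boundary by (intro outer_normal_ex1)
  moreover have "norm (dir t) = 1 \<and> (\<forall>y\<in>oval a b. dir t \<bullet> (y - oval_point a b t) \<le> 0)"
    using oval_le by (auto simp: inner_diff_right)
  ultimately show ?thesis unfolding outer_normal_def by (rule the1_equality)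
qed

text \<open>
  A ray that starts on the boundary meets it at most once more. Otherwise the nearer of the two
  points would lie between two points of the oval, so the supporting line at the nearer point would
  also touch at the start of the ray, against \<open>oval_contact_unique\<close>. This makes the billiard
  dynamics deterministic in both tables.
\<close>

lemma oval_chord_unique:
  assumes "x \<in> frontier (oval a b)" "x + c *\<^sub>R v \<in> frontier (oval a b)"
    "x + d *\<^sub>R v \<in> frontier (oval a b)" "0 < c" "0 < d"
  shows "x + c *\<^sub>R v = x + d *\<^sub>R v"
proof -
  have sub: "y \<in> oval a b" if "y \<in> frontier (oval a b)" for y
    using that oval_point_in_oval by (auto simp: frontier_oval)
  have *: "v = 0" if c: "0 < c" "c < d" and fr: "x + c *\<^sub>R v \<in> frontier (oval a b)"
    "x + d *\<^sub>R v \<in> frontier (oval a b)" for c d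
  proof -
    obtain t where t: "x + c *\<^sub>R v = oval_point a b t" using fr by (auto simp: frontier_oval)
    have eq: "dir t \<bullet> x + c * (dir t \<bullet> v) = oval_support a b t"
      using arg_cong[OF t, of "(\<bullet>) (dir t)"] by (simp add: inner_add_right)
    have 0: "dir t \<bullet> x \<le> oval_support a b t" using oval_le sub assms(1) by blast
    have "dir t \<bullet> (x + d *\<^sub>R v) \<le> oval_support a b t" using oval_le sub fr by blast
    then have "(d - c) * (dir t \<bullet> v) \<le> 0" using eq by (simp add: inner_add_right algebra_simps)
    then have "dir t \<bullet> v \<le> 0" using c by (simp add: mult_le_0_iff)
    moreover have "0 \<le> c * (dir t \<bullet> v)" using 0 eq by linarith
    ultimately have "dir t \<bullet> v = 0" using c by (simp add: zero_le_mult_iff)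
    then have "x = oval_point a b t"
      using eq sub assms(1) by (intro oval_contact_unique) auto
    then show "v = 0" using t c by simp
  qed
  show ?thesis
    using *[of c d] *[of d c] assms by (cases c d rule: linorder_cases) auto
qed

lemma oval_centrally_symmetric: "centrally_symmetric (oval a b)"
proof -
  have *: "- x \<in> oval a b" if "x \<in> oval a b" for x
  proof -
    have "dir t \<bullet> (- x) \<le> oval_support a b t" for t
    proof -
      have "cos (4 * (t + pi)) = cos (4 * t)"
        unfolding quadruple_angle by simp
      then show ?thesis
        using oval_le[OF that, of "t + pi"] by (simp add: dir_add_pi oval_support_def)
    qed
    then show ?thesis by (simp add: oval_def)
  qed
  have "x \<in> uminus ` oval a b" if "x \<in> oval a b" for x
    using *[OF that] by (intro image_eqI[of _ _ "- x"]) auto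
  then show ?thesis using * unfolding centrally_symmetric_def by blast
qed

end
lemma billiard_trajectoryD:
  assumes "billiard_trajectory K T q p"
  shows "q k \<in> frontier K" "p k \<in> frontier T"
    "\<exists>c>0. q (k + 1) - q k = c *\<^sub>R - outer_normal T (p k)"
    "\<exists>c>0. p (k + 1) - p k = c *\<^sub>R outer_normal K (q (k + 1))"
  using assms unfolding billiard_trajectory_def by blast+

section \<open>The chords of the oval that subtend the Gutkin angle\<close>

context
  fixes \<beta> :: real
  assumes \<beta>: "(cos \<beta>)\<^sup>2 = 1/6"
begin

lemma cos_sin_quadruple_\<beta>:
  "cos (4 * \<beta>) = - 1/9" "sin (4 * \<beta>) = - 8/3 * (sin \<beta> * cos \<beta>)" "(sin \<beta>)\<^sup>2 = 5/6"
proof -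
  have "cos \<beta> ^ 4 = ((cos \<beta>)\<^sup>2)\<^sup>2" "cos \<beta> ^ 3 = (cos \<beta>)\<^sup>2 * cos \<beta>"
    by (simp_all add: power3_eq_cube power4_eq_xxxx power2_eq_square)
  then have "cos \<beta> ^ 4 = 1/36" "cos \<beta> ^ 3 = cos \<beta> / 6"
    unfolding \<beta> by (simp_all add: power2_eq_square)
  then show "cos (4 * \<beta>) = - 1/9" "sin (4 * \<beta>) = - 8/3 * (sin \<beta> * cos \<beta>)" "(sin \<beta>)\<^sup>2 = 5/6"
    using \<beta> by (simp_all only: quadruple_angle sin_squared_eq) simp_all
qed

text \<open>
  The first two lines agree, so the chord is orthogonal to \<open>\<tau>\<close>; this is where
  \<open>tan (4\<beta>) = 4 tan \<beta>\<close> enters. Their common value is the position of the chord, with the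
  amplification factor \<open>cos 4\<beta> (1 + 16 tan\<^sup>2 \<beta>) = - 9\<close> on the oscillating part.
\<close>

lemma oval_point_coordinates:
  "dir \<tau> \<bullet> oval_point 18 1 (\<tau> + \<beta>) = cos \<beta> * (18 - 9 * cos (4 * \<tau>))"
  "dir \<tau> \<bullet> oval_point 18 1 (\<tau> - \<beta>) = cos \<beta> * (18 - 9 * cos (4 * \<tau>))"
  "dir (\<tau> + pi/2) \<bullet> oval_point 18 1 (\<tau> + \<beta>) - dir (\<tau> + pi/2) \<bullet> oval_point 18 1 (\<tau> - \<beta>)
     = sin \<beta> * (36 + 10/3 * cos (4 * \<tau>))"
proof -
  define c where "c = cos \<beta>"
  define s where "s = sin \<beta>"
  define C where "C = cos (4 * \<tau>)"
  define S where "S = sin (4 * \<tau>)"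
  have cs: "c^2 = 1/6" "s^2 = 5/6" using \<beta> cos_sin_quadruple_\<beta> by (simp_all add: c_def s_def)
  have plus: "cos (4 * (\<tau> + \<beta>)) = - C / 9 + 8/3 * S * s * c"
    "sin (4 * (\<tau> + \<beta>)) = - S / 9 - 8/3 * C * s * c"
    unfolding distrib_left cos_add sin_add cos_sin_quadruple_\<beta>
    by (simp_all add: C_def S_def c_def s_def)
  have minus: "cos (4 * (\<tau> - \<beta>)) = - C / 9 - 8/3 * S * s * c"
    "sin (4 * (\<tau> - \<beta>)) = - S / 9 + 8/3 * C * s * c"
    unfolding right_diff_distrib cos_diff sin_diff cos_sin_quadruple_\<beta>
    by (simp_all add: C_def S_def c_def s_def)
  have quarter: "cos (\<tau> + pi/2 - (\<tau> + \<beta>)) = s" "sin (\<tau> + pi/2 - (\<tau> + \<beta>)) = c"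
    "cos (\<tau> + pi/2 - (\<tau> - \<beta>)) = - s" "sin (\<tau> + pi/2 - (\<tau> - \<beta>)) = c"
    by (simp_all add: c_def s_def cos_add sin_add cos_diff sin_diff)
  have near: "cos (\<tau> - (\<tau> + \<beta>)) = c" "sin (\<tau> - (\<tau> + \<beta>)) = - s"
    "cos (\<tau> - (\<tau> - \<beta>)) = c" "sin (\<tau> - (\<tau> - \<beta>)) = s"
    by (simp_all add: c_def s_def)
  show "dir \<tau> \<bullet> oval_point 18 1 (\<tau> + \<beta>) = cos \<beta> * (18 - 9 * cos (4 * \<tau>))"
    "dir \<tau> \<bullet> oval_point 18 1 (\<tau> - \<beta>) = cos \<beta> * (18 - 9 * cos (4 * \<tau>))"
    "dir (\<tau> + pi/2) \<bullet> oval_point 18 1 (\<tau> + \<beta>) - dir (\<tau> + pi/2) \<bullet> oval_point 18 1 (\<tau> - \<beta>)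
     = sin \<beta> * (36 + 10/3 * cos (4 * \<tau>))"
    unfolding inner_dir_oval_point oval_support_def plus minus quarter near
    unfolding c_def[symmetric] s_def[symmetric] C_def[symmetric]
    using cs by algebra+
qed

lemma oval_point_diff:
  "oval_point 18 1 (\<tau> + \<beta>) - oval_point 18 1 (\<tau> - \<beta>)
     = (sin \<beta> * (36 + 10/3 * cos (4 * \<tau>))) *\<^sub>R dir (\<tau> + pi/2)"
  by (rule dir_coordinates_eqI[of \<tau>])
     (simp_all add: inner_diff_right oval_point_coordinates inner_dir_dir)

end

section \<open>The billiard configuration\<close>

definition table :: "(real^2) set" where "table = oval 1 0"

definition dual_table :: "(real^2) set" where "dual_table = oval 18 1"

definition caustic :: "(real^2) set" where "caustic = oval (sqrt (1/6)) 0"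

text \<open>
  The state of a trajectory at a segment with normal direction \<open>\<psi>\<close> that touches the caustic. For
  \<open>sin \<beta> > 0\<close> the segment has direction \<open>\<psi> + \<pi>/2\<close>, whose opposite \<open>\<psi> - \<pi>/2\<close> has to be the
  normal of the dual table at \<open>p k\<close>. The two orientations of the segment correspond to the two signs
  of \<open>cos \<beta>\<close>, so a single notion covers both.
\<close>

definition on_caustic :: "(int \<Rightarrow> real^2) \<Rightarrow> (int \<Rightarrow> real^2) \<Rightarrow> real \<Rightarrow> int \<Rightarrow> real \<Rightarrow> bool" where
  "on_caustic q p \<beta> k \<psi> \<longleftrightarrow>
     q k = dir (\<psi> - \<beta>) \<and> q (k + 1) = dir (\<psi> + \<beta>) \<and> p k = oval_point 18 1 (\<psi> - pi/2)"

lemma frontier_table: "frontier table = range dir"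
  unfolding table_def by (subst frontier_oval) (simp_all add: oval_point_disk[abs_def])

lemma frontier_dual_table: "frontier dual_table = range (oval_point 18 1)"
  unfolding dual_table_def by (rule frontier_oval) simp

lemma outer_normal_table [simp]: "outer_normal table (dir t) = dir t"
  using outer_normal_oval[of 0 1 t] by (simp add: table_def oval_point_disk)

lemma outer_normal_dual_table [simp]: "outer_normal dual_table (oval_point 18 1 t) = dir t"
  unfolding dual_table_def by (rule outer_normal_oval) simp

lemma table_chord_unique:
  assumes "x \<in> frontier table" "y \<in> frontier table" "z \<in> frontier table"
    "y - x = c *\<^sub>R v" "z - x = d *\<^sub>R v" "0 < c" "0 < d"
  shows "y = z"
proof -
  have "y = x + c *\<^sub>R v" "z = x + d *\<^sub>R v" using assms by (simp_all add: diff_eq_eq add.commute)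
  then show ?thesis using oval_chord_unique[of 0 1 x c v d] assms by (simp add: table_def)
qed

lemma dual_table_chord_unique:
  assumes "x \<in> frontier dual_table" "y \<in> frontier dual_table" "z \<in> frontier dual_table"
    "y - x = c *\<^sub>R v" "z - x = d *\<^sub>R v" "0 < c" "0 < d"
  shows "y = z"
proof -
  have "y = x + c *\<^sub>R v" "z = x + d *\<^sub>R v" using assms by (simp_all add: diff_eq_eq add.commute)
  then show ?thesis using oval_chord_unique[of 1 18 x c v d] assms by (simp add: dual_table_def)
qed

lemma caustic_subset_interior: "caustic \<subseteq> interior table"
proof
  fix x assume x: "x \<in> caustic"
  have "sqrt (1/6) < (1::real)" by (simp add: real_sqrt_lt_1_iff)
  then have "dir t \<bullet> x < oval_support 1 0 t" for t
    using oval_le[OF x[unfolded caustic_def], of t] by (simp only: oval_support_def)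
  then show "x \<in> interior table" unfolding table_def by (intro oval_interior) auto
qed

lemma caustic_strictly_convex_body: "strictly_convex_body caustic"
  and caustic_C1_smooth_boundary: "C1_smooth_boundary caustic"
  unfolding caustic_def by (auto intro!: oval_strictly_convex_body oval_C1_smooth_boundary)

lemma symmetric_configuration: "symmetric_billiard_configuration table dual_table"
  unfolding symmetric_billiard_configuration_def table_def dual_table_def
  by (auto intro!: oval_strictly_convex_body oval_C1_smooth_boundary oval_centrally_symmetric)

section \<open>Trajectories that touch the caustic\<close>

lemma cos_squared_sixth_cases:
  assumes "(cos \<beta>)\<^sup>2 = 1/6" obtains "cos \<beta> = sqrt (1/6)" | "cos \<beta> = - sqrt (1/6)"
  using assms by (metis power2_eq_iff real_sqrt_abs abs_real_def)

context
  fixes \<beta> :: real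
  assumes cos_\<beta>: "(cos \<beta>)\<^sup>2 = 1/6" and sin_\<beta>: "sin \<beta> > 0"
begin

lemma table_step: "dir (\<psi> + \<beta>) - dir (\<psi> - \<beta>) = (2 * sin \<beta>) *\<^sub>R (- dir (\<psi> - pi/2))"
proof -
  have "dir (\<psi> + pi/2) = - dir (\<psi> - pi/2)" using dir_add_pi[of "\<psi> - pi/2"] by (simp add: add.commute)
  then show ?thesis using dir_diff[of \<psi> \<beta>] by simp
qed

text \<open>
  The reflection law at \<open>q (k + 1) = dir (\<psi> + \<beta>)\<close>: the step in the dual table has the direction of
  the normal of the disk there, and turns the segment by \<open>2\<beta>\<close>.
\<close>

lemma dual_table_step:
  obtains c where "c > 0"
    "oval_point 18 1 (\<psi> + 2 * \<beta> - pi/2) - oval_point 18 1 (\<psi> - pi/2) = c *\<^sub>R dir (\<psi> + \<beta>)"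
proof
  have e: "\<psi> + \<beta> - pi/2 + \<beta> = \<psi> + 2 * \<beta> - pi/2" "\<psi> + \<beta> - pi/2 - \<beta> = \<psi> - pi/2"
    "\<psi> + \<beta> - pi/2 + pi/2 = \<psi> + \<beta>" by simp_all
  define \<tau> where "\<tau> = \<psi> + \<beta> - pi/2"
  show "oval_point 18 1 (\<psi> + 2 * \<beta> - pi/2) - oval_point 18 1 (\<psi> - pi/2)
      = (sin \<beta> * (36 + 10/3 * cos (4 * \<tau>))) *\<^sub>R dir (\<psi> + \<beta>)"
    using oval_point_diff[OF cos_\<beta>, of \<tau>] e by (simp only: \<tau>_def)
  have "-1 \<le> cos (4 * \<tau>)" by simp
  then have "36 + 10/3 * cos (4 * \<tau>) > 0" by linarith
  then show "sin \<beta> * (36 + 10/3 * cos (4 * \<tau>)) > 0" using sin_\<beta> by simp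
qed

text \<open>
  Reflection at the next vertices can only lead to the points named here, as these lie on the
  boundary and on the rays that the two reflection laws prescribe.
\<close>

lemma on_caustic_forward:
  assumes bt: "billiard_trajectory table dual_table q p" and k: "on_caustic q p \<beta> k \<psi>"
  shows "on_caustic q p \<beta> (k + 1) (\<psi> + 2 * \<beta>)"
proof -
  have q: "q (k + 1) = dir (\<psi> + \<beta>)" and p: "p k = oval_point 18 1 (\<psi> - pi/2)"
    using k by (auto simp: on_caustic_def)
  obtain c where c: "c > 0" "p (k + 1) - p k = c *\<^sub>R dir (\<psi> + \<beta>)"
    using billiard_trajectoryD(4)[OF bt, of k] q by auto
  obtain d where d: "d > 0"
    "oval_point 18 1 (\<psi> + 2 * \<beta> - pi/2) - oval_point 18 1 (\<psi> - pi/2) = d *\<^sub>R dir (\<psi> + \<beta>)"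
    by (rule dual_table_step)
  have p1: "p (k + 1) = oval_point 18 1 (\<psi> + 2 * \<beta> - pi/2)"
  proof (rule dual_table_chord_unique[OF _ _ _ c(2) _ c(1) d(1)])
    show "oval_point 18 1 (\<psi> + 2 * \<beta> - pi/2) - p k = d *\<^sub>R dir (\<psi> + \<beta>)"
      unfolding p by (rule d(2))
  qed (simp_all add: billiard_trajectoryD(2)[OF bt], simp add: frontier_dual_table)
  obtain c where c: "c > 0" "q (k + 1 + 1) - q (k + 1) = c *\<^sub>R (- dir (\<psi> + 2 * \<beta> - pi/2))"
    using billiard_trajectoryD(3)[OF bt, of "k + 1"] p1 by auto
  have "\<psi> + 2 * \<beta> - \<beta> = \<psi> + \<beta>" by simp
  then have "dir (\<psi> + 2 * \<beta> + \<beta>) - q (k + 1) = (2 * sin \<beta>) *\<^sub>R (- dir (\<psi> + 2 * \<beta> - pi/2))"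
    using table_step[of "\<psi> + 2 * \<beta>"] q by (simp only:)
  then have q2: "q (k + 1 + 1) = dir (\<psi> + 2 * \<beta> + \<beta>)"
  proof (intro table_chord_unique[OF _ _ _ c(2) _ c(1)])
    show "0 < 2 * sin \<beta>" using sin_\<beta> by simp
  qed (simp_all only: billiard_trajectoryD(1)[OF bt], simp add: frontier_table)
  show ?thesis
    unfolding on_caustic_def q2 p1 q \<open>\<psi> + 2 * \<beta> - \<beta> = \<psi> + \<beta>\<close> by blast
qed

lemma on_caustic_backward:
  assumes bt: "billiard_trajectory table dual_table q p" and k: "on_caustic q p \<beta> k \<psi>"
  shows "on_caustic q p \<beta> (k - 1) (\<psi> - 2 * \<beta>)"
proof -
  have q: "q k = dir (\<psi> - \<beta>)" and p: "p k = oval_point 18 1 (\<psi> - pi/2)"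
    using k by (auto simp: on_caustic_def)
  have "\<exists>c>0. p (k - 1 + 1) - p (k - 1) = c *\<^sub>R outer_normal table (q (k - 1 + 1))"
    by (rule billiard_trajectoryD(4)[OF bt])
  then obtain c where c: "c > 0" "p k - p (k - 1) = c *\<^sub>R dir (\<psi> - \<beta>)"
    using q by auto
  obtain d where d: "d > 0"
    "oval_point 18 1 (\<psi> - pi/2) - oval_point 18 1 (\<psi> - 2 * \<beta> - pi/2) = d *\<^sub>R dir (\<psi> - \<beta>)"
    by (rule dual_table_step[of "\<psi> - 2 * \<beta>"]) (simp add: algebra_simps)
  have p1: "p (k - 1) = oval_point 18 1 (\<psi> - 2 * \<beta> - pi/2)"
  proof (rule dual_table_chord_unique[of "p k" _ _ c "- dir (\<psi> - \<beta>)" d])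
    show "p (k - 1) - p k = c *\<^sub>R - dir (\<psi> - \<beta>)"
      using arg_cong[OF c(2), of uminus] by simp
    show "oval_point 18 1 (\<psi> - 2 * \<beta> - pi/2) - p k = d *\<^sub>R - dir (\<psi> - \<beta>)"
      using arg_cong[OF d(2), of uminus] p by simp
  qed (use billiard_trajectoryD(2)[OF bt] c d in \<open>simp_all add: frontier_dual_table\<close>)
  have "\<exists>c>0. q (k - 1 + 1) - q (k - 1) = c *\<^sub>R - outer_normal dual_table (p (k - 1))"
    by (rule billiard_trajectoryD(3)[OF bt])
  then obtain c where c: "c > 0" "q k - q (k - 1) = c *\<^sub>R - dir (\<psi> - 2 * \<beta> - pi/2)"
    using p1 by auto
  have d: "q k - dir (\<psi> - 2 * \<beta> - \<beta>) = (2 * sin \<beta>) *\<^sub>R - dir (\<psi> - 2 * \<beta> - pi/2)"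
    using table_step[of "\<psi> - 2 * \<beta>"] q by simp
  have "q (k - 1) = dir (\<psi> - 2 * \<beta> - \<beta>)"
  proof (rule table_chord_unique[of "q k" _ _ c "dir (\<psi> - 2 * \<beta> - pi/2)" "2 * sin \<beta>"])
    show "q (k - 1) - q k = c *\<^sub>R dir (\<psi> - 2 * \<beta> - pi/2)"
      using arg_cong[OF c(2), of uminus] by simp
    show "dir (\<psi> - 2 * \<beta> - \<beta>) - q k = (2 * sin \<beta>) *\<^sub>R dir (\<psi> - 2 * \<beta> - pi/2)"
      using arg_cong[OF d, of uminus] by simp
  qed (use billiard_trajectoryD(1)[OF bt] c sin_\<beta> in \<open>simp_all add: frontier_table\<close>)
  moreover have "\<psi> - 2 * \<beta> + \<beta> = \<psi> - \<beta>" by simp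
  ultimately show ?thesis unfolding on_caustic_def using q p1 by simp
qed

lemma on_caustic_all:
  assumes bt: "billiard_trajectory table dual_table q p" and k: "on_caustic q p \<beta> k \<psi>"
  shows "\<exists>\<psi>'. on_caustic q p \<beta> j \<psi>'"
proof (induction j rule: int_induct[of _ k])
  case base then show ?case using k by blast
next
  case (step1 i) then show ?case using on_caustic_forward[OF bt] by blast
next
  case (step2 i) then show ?case using on_caustic_backward[OF bt] by blast
qed

lemma on_caustic_imp_tangent:
  assumes "on_caustic q p \<beta> k \<psi>"
  shows "tangent_line (segment_line q k) caustic"
proof -
  have "q (k + 1) - q k \<noteq> 0" 
    using assms table_step[of \<psi>] sin_\<beta> unfolding on_caustic_def by auto
  then have ne: "q k \<noteq> q (k + 1)" by auto
  have l: "segment_line q k = {x. dir \<psi> \<bullet> x = cos \<beta>}"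
    unfolding segment_line_def using assms ne
    by (intro affine_hull_2_eq_line) (auto simp: on_caustic_def inner_dir_dir)
  have le: "dir t \<bullet> x \<le> sqrt (1/6)" if "x \<in> caustic" for x t
    using oval_le[OF that[unfolded caustic_def]] by (simp add: oval_support_def)
  have pt: "sqrt (1/6) *\<^sub>R dir t \<in> caustic" for t
    using oval_point_in_oval[of 0 "sqrt (1/6)" t] by (simp add: caustic_def oval_point_disk)
  from cos_\<beta> show ?thesis
  proof (cases rule: cos_squared_sixth_cases)
    case 1
    show ?thesis
      unfolding l 1 using le by (intro tangent_lineI[OF _ pt[of \<psi>]]) (simp_all add: inner_dir_dir)
  next
    case 2
    have l': "segment_line q k = {x. dir (\<psi> + pi) \<bullet> x = sqrt (1/6)}"
      unfolding l 2 dir_add_pi by (rule Collect_cong) (simp only: inner_minus_left, linarith)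
    show ?thesis
      unfolding l' using le by (intro tangent_lineI[OF _ pt[of "\<psi> + pi"]]) (simp_all add: inner_dir_dir)
  qed
qed

lemma on_caustic_tangent_trajectory:
  assumes "billiard_trajectory table dual_table q p" "on_caustic q p \<beta> k \<psi>"
  shows "tangent_trajectory q caustic"
  unfolding tangent_trajectory_def
  using on_caustic_all[OF assms] on_caustic_imp_tangent by blast

text \<open>
  Duality constrains a set \<open>C'\<close> only along segments of actual trajectories; this shows that every
  chord of the dual table that subtends the angle \<open>2\<beta>\<close> is such a segment.
\<close>

lemma billiard_trajectory_on_caustic:
  obtains q p where "billiard_trajectory table dual_table q p" "on_caustic q p \<beta> 0 \<psi>"
    "p 1 = oval_point 18 1 (\<psi> + 2 * \<beta> - pi/2)"
proof
  define q where "q k = dir (\<psi> + 2 * \<beta> * of_int k - \<beta>)" for k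
  define p where "p k = oval_point 18 1 (\<psi> + 2 * \<beta> * of_int k - pi/2)" for k
  show "billiard_trajectory table dual_table q p"
    unfolding billiard_trajectory_def
  proof (intro allI conjI)
    fix k
    show "q k \<in> frontier table" "p k \<in> frontier dual_table"
      by (auto simp: q_def p_def frontier_table frontier_dual_table)
    have q1: "q (k + 1) = dir (\<psi> + 2 * \<beta> * of_int k + \<beta>)"
      by (simp add: q_def algebra_simps)
    show "\<exists>c>0. q (k + 1) - q k = c *\<^sub>R - outer_normal dual_table (p k)"
      unfolding q1 unfolding q_def p_def outer_normal_dual_table
      using table_step[of "\<psi> + 2 * \<beta> * of_int k"] sin_\<beta> by (intro exI[of _ "2 * sin \<beta>"]) simp
    have "p (k + 1) = oval_point 18 1 (\<psi> + 2 * \<beta> * of_int k + 2 * \<beta> - pi/2)"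
      by (simp add: p_def algebra_simps)
    moreover obtain c where "c > 0" "oval_point 18 1 (\<psi> + 2 * \<beta> * of_int k + 2 * \<beta> - pi/2) - p k
        = c *\<^sub>R dir (\<psi> + 2 * \<beta> * of_int k + \<beta>)"
      unfolding p_def by (rule dual_table_step)
    ultimately show "\<exists>c>0. p (k + 1) - p k = c *\<^sub>R outer_normal table (q (k + 1))"
      unfolding q1 outer_normal_table by auto
  qed
  show "on_caustic q p \<beta> 0 \<psi>"
    by (simp add: on_caustic_def q_def p_def) (simp add: algebra_simps)
  show "p 1 = oval_point 18 1 (\<psi> + 2 * \<beta> - pi/2)" by (simp add: p_def)
qed

lemma dual_caustic_tangent_line:
  assumes "dual_caustics table dual_table caustic C'"
  shows "tangent_line {x. dir \<tau> \<bullet> x = cos \<beta> * (18 - 9 * cos (4 * \<tau>))} C'"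
proof -
  define \<psi> where "\<psi> = \<tau> - \<beta> + pi/2"
  obtain q p where bt: "billiard_trajectory table dual_table q p" and on: "on_caustic q p \<beta> 0 \<psi>"
    and p1: "p 1 = oval_point 18 1 (\<psi> + 2 * \<beta> - pi/2)"
    by (rule billiard_trajectory_on_caustic)
  have p: "p 0 = oval_point 18 1 (\<tau> - \<beta>)" "p 1 = oval_point 18 1 (\<tau> + \<beta>)"
    using on p1 by (simp_all add: on_caustic_def \<psi>_def algebra_simps)
  have "p 0 \<noteq> p 1"
  proof -
    obtain c where "c > 0" "p 1 - p 0 = c *\<^sub>R dir (\<psi> + \<beta>)"
      using p1 on dual_table_step[of \<psi>] unfolding on_caustic_def by auto
    then show ?thesis by auto
  qed
  then have "segment_line p 0 = {x. dir \<tau> \<bullet> x = cos \<beta> * (18 - 9 * cos (4 * \<tau>))}"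
    unfolding segment_line_def
    by (intro affine_hull_2_eq_line) (simp_all add: p oval_point_coordinates[OF cos_\<beta>])
  moreover have "tangent_trajectory p C'"
    using assms bt on_caustic_tangent_trajectory[OF bt on] unfolding dual_caustics_def by blast
  ultimately show ?thesis unfolding tangent_trajectory_def by metis
qed

end

text \<open>
  The chord lies at distance \<open>sqrt (1/6)\<close> from the centre of the unit disk, so the polar angles of its
  endpoints differ from that of its normal by \<open>\<plusminus>\<beta>\<close>.
\<close>

lemma tangent_segment_imp_on_caustic:
  assumes bt: "billiard_trajectory table dual_table q p"
    and tan: "tangent_line (segment_line q k) caustic"
  obtains \<beta> \<psi> where "(cos \<beta>)\<^sup>2 = 1/6" "sin \<beta> > 0" "on_caustic q p \<beta> k \<psi>"
proof -
  define r where "r = sqrt (1/6)"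
  have r: "r > 0" "r^2 = 1/6" by (simp_all add: r_def)
  obtain \<theta> c where l: "segment_line q k = {x. dir \<theta> \<bullet> x = c}"
    "caustic \<subseteq> {x. dir \<theta> \<bullet> x \<le> c}" "segment_line q k \<inter> caustic \<noteq> {}"
    using tan by (rule tangent_line_dirE)
  then obtain x where x: "x \<in> caustic" "dir \<theta> \<bullet> x = c" by blast
  have "c \<le> r"
    using oval_le[of x r 0 \<theta>] x by (simp add: caustic_def r_def oval_support_def)
  moreover have "r \<le> c"
    using subsetD[OF l(2), of "r *\<^sub>R dir \<theta>"] oval_point_in_oval[of 0 r \<theta>] r(1)
    by (simp add: caustic_def r_def oval_point_disk inner_dir_dir)
  ultimately have c: "c = r" by simp
  have "{q k, q (k + 1)} \<subseteq> segment_line q k" unfolding segment_line_def by (rule hull_subset)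
  then have on: "dir \<theta> \<bullet> q k = r" "dir \<theta> \<bullet> q (k + 1) = r" using l(1) c by auto
  obtain s t where st: "q k = dir s" "q (k + 1) = dir t"
    using billiard_trajectoryD(1)[OF bt] unfolding frontier_table by blast
  obtain t' where t': "p k = oval_point 18 1 t'"
    using billiard_trajectoryD(2)[OF bt] unfolding frontier_dual_table by blast
  obtain d where d: "d > 0" "q (k + 1) - q k = d *\<^sub>R - dir t'"
    using billiard_trajectoryD(3)[OF bt, of k] t' by auto
  then have ne: "dir s \<noteq> dir t" using st by auto
  have cst: "cos (s - \<theta>) = r" "cos (t - \<theta>) = r"
    using on st by (simp_all add: inner_dir_dir cos_diff mult.commute)
  have "sin (s - \<theta>) \<noteq> sin (t - \<theta>)"
  proof
    assume "sin (s - \<theta>) = sin (t - \<theta>)"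
    then have "cos ((s - \<theta>) - (t - \<theta>)) = 1"
      using cst sin_cos_squared_add[of "t - \<theta>"]
      by (simp only: cos_diff[of "s - \<theta>"]) (simp add: power2_eq_square)
    then show False using ne cos_diff_1_imp_dir_eq[of s t] by simp
  qed
  moreover have "(sin (s - \<theta>))^2 = (sin (t - \<theta>))^2" by (simp add: sin_squared_eq cst)
  ultimately have sst: "sin (s - \<theta>) = - sin (t - \<theta>)" by (metis power2_eq_iff)
  define \<beta> where "\<beta> = t - \<theta>"
  have "t = \<theta> + \<beta>" by (simp add: \<beta>_def)
  have "cos (s - (\<theta> - \<beta>)) = cos ((s - \<theta>) + (t - \<theta>))" by (simp add: \<beta>_def algebra_simps)
  also have "\<dots> = 1" 
    using cst sst sin_cos_squared_add[of "t - \<theta>"]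
    by (simp only: cos_add[of "s - \<theta>"]) (simp add: power2_eq_square)
  finally have s: "dir s = dir (\<theta> - \<beta>)" by (rule cos_diff_1_imp_dir_eq)
  have cb: "(cos \<beta>)\<^sup>2 = 1/6" using cst r by (simp add: \<beta>_def)
  have sb: "sin \<beta> \<noteq> 0" using \<open>sin (s - \<theta>) \<noteq> sin (t - \<theta>)\<close> sst by (auto simp: \<beta>_def)
  \<comment> \<open>The sign of \<open>sin \<beta>\<close> is made positive by adding \<open>\<pi>\<close> to both \<open>\<beta>\<close> and \<open>\<theta>\<close>, which changes
     neither endpoint.\<close>
  obtain \<beta>' \<psi> where b: "(cos \<beta>')\<^sup>2 = 1/6" "sin \<beta>' > 0" "q k = dir (\<psi> - \<beta>')" "q (k + 1) = dir (\<psi> + \<beta>')"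
  proof (cases "sin \<beta> > 0")
    case True
    then show ?thesis using that[of \<beta> \<theta>] cb s st \<open>t = \<theta> + \<beta>\<close> by simp
  next
    case False
    have "dir (\<theta> + pi - (\<beta> + pi)) = dir (\<theta> - \<beta>)" "dir (\<theta> + pi + (\<beta> + pi)) = dir (\<theta> + \<beta>)"
      using dir_periodic[of "\<theta> + \<beta>"] by (simp_all add: algebra_simps)
    then show ?thesis using that[of "\<beta> + pi" "\<theta> + pi"] False sb cb s st \<open>t = \<theta> + \<beta>\<close> by simp
  qed
  have "(2 * sin \<beta>') *\<^sub>R - dir (\<psi> - pi/2) = d *\<^sub>R - dir t'"
    using table_step[of \<beta>' \<psi>] b d by simp
  moreover from arg_cong[OF this, of norm] have "2 * sin \<beta>' = d" using b d by simp
  ultimately have "dir (\<psi> - pi/2) = dir t'" using d by simp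
  then have "p k = oval_point 18 1 (\<psi> - pi/2)" using t' oval_point_cong by metis
  then show ?thesis using that b by (auto simp: on_caustic_def)
qed

lemma caustic_is_T_caustic: "convex_T_caustic table dual_table caustic"
  unfolding convex_T_caustic_def convex_caustic_def
proof (intro conjI ballI impI)
  show "caustic \<noteq> {}" "compact caustic" "convex caustic"
    using caustic_strictly_convex_body unfolding strictly_convex_body_def convex_body_def
    by auto
  show "caustic \<subseteq> interior table" by (rule caustic_subset_interior)
  fix q assume "q \<in> q_trajectories table dual_table" "\<exists>k. tangent_line (segment_line q k) caustic"
  then obtain p k where bt: "billiard_trajectory table dual_table q p"
    and "tangent_line (segment_line q k) caustic"
    unfolding q_trajectories_def by blast
  then show "tangent_trajectory q caustic"
    by (metis tangent_segment_imp_on_caustic on_caustic_tangent_trajectory)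
qed

section \<open>The absence of a convex dual\<close>

text \<open>
  A dual caustic touches the lines in all directions \<open>\<tau>\<close> at the offset \<open>H \<tau>\<close>. As it also touches
  the line in the opposite direction, which lies on the other side of the origin, it must lie on the
  inner side of each line, and \<open>H\<close> would be its support function. But \<open>H\<close> is too large at
  \<open>\<pi>/4\<close> compared with \<open>0\<close> and \<open>\<pi>/2\<close>.
\<close>

lemma no_dual_caustic: "\<not> dual_caustics table dual_table caustic C'"
proof
  assume dual: "dual_caustics table dual_table caustic C'"
  define r where "r = sqrt (1/6)"
  define \<beta> where "\<beta> = arccos r"
  have r: "0 < r" "r < 1" by (simp_all add: r_def real_sqrt_lt_1_iff)
  have cb: "cos \<beta> = r" using r by (simp add: \<beta>_def)
  have cb2: "(cos \<beta>)\<^sup>2 = 1/6" unfolding cb by (simp add: r_def)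
  have sb: "sin \<beta> > 0"
    unfolding \<beta>_def using r arccos_lt_bounded[of r] by (intro sin_gt_zero) auto
  define H where "H \<tau> = r * (18 - 9 * cos (4 * \<tau>))" for \<tau>
  have tan: "tangent_line {x. dir \<tau> \<bullet> x = H \<tau>} C'" for \<tau>
    using dual_caustic_tangent_line[OF cb2 sb dual] cb by (simp add: H_def)
  have Hpos: "H \<tau> > 0" for \<tau>
    using r cos_le_one[of "4 * \<tau>"] unfolding H_def by (intro mult_pos_pos) linarith+
  have touch: "\<exists>x\<in>C'. dir \<tau> \<bullet> x = H \<tau>" for \<tau>
    using tan[of \<tau>] unfolding tangent_line_def by blast
  have le: "dir \<tau> \<bullet> x \<le> H \<tau>" if x: "x \<in> C'" for x \<tau>
  proof -
    obtain \<theta> c where l: "{x. dir \<tau> \<bullet> x = H \<tau>} = {x. dir \<theta> \<bullet> x = c}"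
      and "C' \<subseteq> {x. dir \<theta> \<bullet> x \<le> c}"
      using tan[of \<tau>] by (rule tangent_line_dirE)
    then have side: "dir \<theta> \<bullet> y \<le> c" if "y \<in> C'" for y using that by blast
    obtain y where y: "y \<in> C'" "dir (\<tau> + pi) \<bullet> y = H (\<tau> + pi)" using touch by blast
    from line_dir_unique[OF l] show ?thesis
    proof (elim disjE conjE)
      assume "dir \<theta> = dir \<tau>" "c = H \<tau>" then show ?thesis using side x by metis
    next
      assume "dir \<theta> = - dir \<tau>" "c = - H \<tau>"
      then show ?thesis using side[OF y(1)] y(2) Hpos[of \<tau>] Hpos[of "\<tau> + pi"]
        by (simp add: dir_add_pi)
    qed
  qed
  obtain x where x: "x \<in> C'" "dir (pi/4) \<bullet> x = H (pi/4)" using touch by blast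
  have H: "H 0 = 9 * r" "H (pi/2) = 9 * r" "H (pi/4) = 27 * r" by (simp_all add: H_def)
  have "27 * r = sqrt 2 / 2 * (x$1 + x$2)"
    using x(2) by (simp add: H inner_dir cos_45 sin_45 algebra_simps)
  also have "\<dots> \<le> sqrt 2 / 2 * (18 * r)"
    using le[OF x(1), of 0] le[OF x(1), of "pi/2"]
    by (intro mult_left_mono) (simp_all add: H inner_dir)
  also have "\<dots> \<le> 1 * (18 * r)"
    using r by (intro mult_right_mono) (auto simp: real_le_lsqrt)
  finally show False using r by simp
qed

theorem theorem1p6:
  shows "\<exists>K T C :: (real^2) set.
           symmetric_billiard_configuration K T \<and>
           smooth_strictly_convex_T_caustic K T C \<and>
           \<not> (\<exists>C'. convex_K_caustic K T C' \<and> dual_caustics K T C C')"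
proof (intro exI conjI)
  show "symmetric_billiard_configuration table dual_table" by (rule symmetric_configuration)
  show "smooth_strictly_convex_T_caustic table dual_table caustic"
    unfolding smooth_strictly_convex_T_caustic_def
    using caustic_is_T_caustic caustic_strictly_convex_body caustic_C1_smooth_boundary by blast
  show "\<not> (\<exists>C'. convex_K_caustic table dual_table C' \<and> dual_caustics table dual_table caustic C')"
    using no_dual_caustic by blast
qed

end
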